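(* Consider the semigroup $U=\mathcal M_{m-r,r}\times\mathcal M_r\times\mathcal M_{r,n-r}$ under the operation $\diamond$ defined by $$(M,A,N)\diamond(K,B,L)=(M,AB,L).$$ Define an equivalence $\sim$ on $U$ by $$(M,A,N)\sim(K,B,L)\iff A=B,\ MA=KB\ \text{and}\ AN=BL.$$ Then $\sim$ is a congruence on $U$, and the map $$\xi:U\to P=\operatorname{Reg}(\mathcal M_{mn}^J):\ (M,A,N)\mapsto[M,A,N]=\begin{bmatrix}A&AN\\ MA&MAN\end{bmatrix}$$ is an epimorphism (surjective semigroup homomorphism) with $\ker(\xi)={\sim}$. In particular, $P\cong U/{\sim}$.
   Context: Let $\mathbb F$ be a field, $m,n\geq1$ integers, and $0\leq r\leq\min(m,n)$. $\mathcal M_{kl}$ denotes the set of all $k\times l$ matrices over $\mathbb F$ (a single empty matrix if $k=0$ or $l=0$), and $\mathcal M_k=\mathcal M_{kk}$. Let $J=\begin{bmatrix}I_r&O\\O&O\end{bmatrix}\in\mathcal M_{nm}$ (an $n\times m$ matrix), and let $\mathcal M_{mn}^J$ be the semigroup with underlying set $\mathcal M_{mn}$ and operation $X\star Y=XJY$. $P=\operatorname{Reg}(\mathcal M_{mn}^J)$ is the subsemigroup of all regular elements (those $X$ with $X=X\star Y\star X$ for some $Y$). A congruence on a semigroup is an equivalence compatible with multiplication on both sides; the kernel of a semigroup homomorphism $f:S\to T$ is the congruence $\ker(f)=\{(x,y)\in S\times S:f(x)=f(y)\}$. *)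

theory Defs
  imports Jordan_Normal_Form.Matrix
begin

text \<open>
  HOL-Algebra has no structure type for semigroups. Semigroups are represented here by monoid
  records whose field \<^const>\<open>one\<close> is irrelevant: it is never referred to, neither below nor by the
  library notions \<^const>\<open>hom\<close>, \<^const>\<open>epi\<close> and \<^const>\<open>is_iso\<close>, which involve only
  \<^const>\<open>carrier\<close> and \<^const>\<open>mult\<close>.
\<close>

definition is_semigroup :: "('a, 'b) monoid_scheme \<Rightarrow> bool" where
  "is_semigroup S \<longleftrightarrow>
     (\<forall>x \<in> carrier S. \<forall>y \<in> carrier S. x \<otimes>\<^bsub>S\<^esub> y \<in> carrier S) \<and>
     (\<forall>x \<in> carrier S. \<forall>y \<in> carrier S. \<forall>z \<in> carrier S.
        (x \<otimes>\<^bsub>S\<^esub> y) \<otimes>\<^bsub>S\<^esub> z = x \<otimes>\<^bsub>S\<^esub> (y \<otimes>\<^bsub>S\<^esub> z))"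

definition regular_elements :: "('a, 'b) monoid_scheme \<Rightarrow> 'a set" where
  "regular_elements S = {x \<in> carrier S. \<exists>y \<in> carrier S. x = x \<otimes>\<^bsub>S\<^esub> y \<otimes>\<^bsub>S\<^esub> x}"

definition Reg :: "('a, 'b) monoid_scheme \<Rightarrow> ('a, 'b) monoid_scheme" where
  "Reg S = S\<lparr>carrier := regular_elements S\<rparr>"

definition semigroup_congruence :: "('a, 'b) monoid_scheme \<Rightarrow> ('a \<times> 'a) set \<Rightarrow> bool" where
  "semigroup_congruence S R \<longleftrightarrow>
     equiv (carrier S) R \<and>
     (\<forall>(x, y) \<in> R. \<forall>z \<in> carrier S.
        (z \<otimes>\<^bsub>S\<^esub> x, z \<otimes>\<^bsub>S\<^esub> y) \<in> R \<and> (x \<otimes>\<^bsub>S\<^esub> z, y \<otimes>\<^bsub>S\<^esub> z) \<in> R)"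

definition semigroup_ker :: "('a, 'b) monoid_scheme \<Rightarrow> ('a \<Rightarrow> 'c) \<Rightarrow> ('a \<times> 'a) set" where
  "semigroup_ker S f = {(x, y) \<in> carrier S \<times> carrier S. f x = f y}"

definition semigroup_quotient :: "('a, 'b) monoid_scheme \<Rightarrow> ('a \<times> 'a) set \<Rightarrow> 'a set monoid" where
  "semigroup_quotient S R =
     \<lparr>carrier = carrier S // R,
      mult = (\<lambda>X Y. \<Union>x \<in> X. \<Union>y \<in> Y. R `` {x \<otimes>\<^bsub>S\<^esub> y}),
      one = undefined\<rparr>"

lemma semigroup_quotient_mult:
  assumes S: "is_semigroup S" and R: "semigroup_congruence S R"
    and x: "x \<in> carrier S" and y: "y \<in> carrier S"
  shows "(R `` {x}) \<otimes>\<^bsub>semigroup_quotient S R\<^esub> (R `` {y}) = R `` {x \<otimes>\<^bsub>S\<^esub> y}"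
proof -
  have eq: "equiv (carrier S) R"
    using R by (simp add: semigroup_congruence_def)
  have "R `` {a \<otimes>\<^bsub>S\<^esub> b} = R `` {x \<otimes>\<^bsub>S\<^esub> y}" if a: "(x, a) \<in> R" and b: "(y, b) \<in> R" for a b
  proof -
    have "a \<in> carrier S"
      using a eq by (auto simp: equiv_def)
    then have "(a \<otimes>\<^bsub>S\<^esub> y, a \<otimes>\<^bsub>S\<^esub> b) \<in> R" and "(x \<otimes>\<^bsub>S\<^esub> y, a \<otimes>\<^bsub>S\<^esub> y) \<in> R"
      using R a b y by (auto simp: semigroup_congruence_def)
    then have "(x \<otimes>\<^bsub>S\<^esub> y, a \<otimes>\<^bsub>S\<^esub> b) \<in> R"
      using eq by (auto simp: equiv_def intro: transD)
    then show ?thesis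
      using equiv_class_eq[OF eq] by simp
  qed
  then have "(\<Union>a \<in> R `` {x}. \<Union>b \<in> R `` {y}. R `` {a \<otimes>\<^bsub>S\<^esub> b}) =
      (\<Union>a \<in> R `` {x}. \<Union>b \<in> R `` {y}. R `` {x \<otimes>\<^bsub>S\<^esub> y})"
    by (intro SUP_cong) auto
  also have "\<dots> = R `` {x \<otimes>\<^bsub>S\<^esub> y}"
    using equiv_class_self[OF eq x] equiv_class_self[OF eq y] by auto
  finally show ?thesis
    by (simp add: semigroup_quotient_def)
qed

text \<open>The \<open>n \<times> m\<close> matrix \<open>J\<close>; its four blocks have the intended sizes for \<open>r \<le> min m n\<close>.\<close>

definition J_mat :: "nat \<Rightarrow> nat \<Rightarrow> nat \<Rightarrow> 'a :: field mat" where
  "J_mat m n r =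
     four_block_mat (1\<^sub>m r) (0\<^sub>m r (m - r)) (0\<^sub>m (n - r) r) (0\<^sub>m (n - r) (m - r))"

definition sandwich_semigroup :: "'a itself \<Rightarrow> nat \<Rightarrow> nat \<Rightarrow> nat \<Rightarrow> 'a :: field mat monoid" where
  "sandwich_semigroup _ m n r =
     \<lparr>carrier = carrier_mat m n,
      mult = (\<lambda>X Y. X * J_mat m n r * Y),
      one = undefined\<rparr>"

definition U_semigroup ::
  "'a itself \<Rightarrow> nat \<Rightarrow> nat \<Rightarrow> nat \<Rightarrow> ('a :: field mat \<times> 'a mat \<times> 'a mat) monoid" where
  "U_semigroup _ m n r =
     \<lparr>carrier = carrier_mat (m - r) r \<times> carrier_mat r r \<times> carrier_mat r (n - r),
      mult = (\<lambda>(M, A, N) (K, B, L). (M, A * B, L)),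
      one = undefined\<rparr>"

definition U_rel ::
  "nat \<Rightarrow> nat \<Rightarrow> nat \<Rightarrow> (('a :: field mat \<times> 'a mat \<times> 'a mat) \<times> ('a mat \<times> 'a mat \<times> 'a mat)) set" where
  "U_rel m n r =
     {((M, A, N), (K, B, L)).
        (M, A, N) \<in> carrier (U_semigroup TYPE('a) m n r) \<and>
        (K, B, L) \<in> carrier (U_semigroup TYPE('a) m n r) \<and>
        A = B \<and> M * A = K * B \<and> A * N = B * L}"

definition xi :: "'a :: field mat \<times> 'a mat \<times> 'a mat \<Rightarrow> 'a mat" where
  "xi = (\<lambda>(M, A, N). four_block_mat A (A * N) (M * A) (M * A * N))"

lemma J_mat_carrier:
  assumes "r \<le> min m n"
  shows "J_mat m n r \<in> carrier_mat n m"
  using assms by (auto simp: J_mat_def)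

lemma is_semigroup_sandwich:
  assumes "r \<le> min m n"
  shows "is_semigroup (sandwich_semigroup TYPE('a :: field) m n r)"
proof -
  note J = J_mat_carrier[OF assms, where 'a = 'a]
  have "X * J_mat m n r * Y * J_mat m n r * Z = X * J_mat m n r * (Y * J_mat m n r * Z)"
    if "X \<in> carrier_mat m n" "Y \<in> carrier_mat m n" "Z \<in> carrier_mat m n" for X Y Z :: "'a mat"
  proof -
    have XJ: "X * J_mat m n r \<in> carrier_mat m m" and YJ: "Y * J_mat m n r \<in> carrier_mat m m"
      using that J by (auto intro: mult_carrier_mat)
    show ?thesis
      using assoc_mult_mat[OF XJ that(2) J] assoc_mult_mat[OF XJ YJ that(3)] by simp
  qed
  then show ?thesis
    using J by (auto simp: is_semigroup_def sandwich_semigroup_def intro!: mult_carrier_mat)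
qed

end

theory Submission
  imports Defs Jordan_Normal_Form.Gauss_Jordan_Elimination
begin

text \<open>
  The map \<open>\<xi>\<close> is multiplicative because \<open>X \<star> Y\<close> depends only on the left block column of \<open>X\<close> and
  the upper block row of \<open>Y\<close>. Its values are regular because a square matrix \<open>A\<close> over a field
  satisfies \<open>A = A E A\<close> for some \<open>E\<close>. Conversely, if \<open>X = X \<star> Y \<star> X\<close> has blocks \<open>A\<close>, \<open>B\<close>, \<open>C\<close>,
  \<open>D\<close> and \<open>E\<close> is the upper left block of \<open>Y\<close>, then \<open>X = [C E, A, E B]\<close>. The remaining claims hold
  for the kernel of any semigroup epimorphism.
\<close>

section \<open>Kernels and quotients of semigroup epimorphisms\<close>

text \<open>Applied to \<open>xi\<close>, this shows that the regular elements form a semigroup,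
  with no separate proof that they are closed under the sandwich product.\<close>

lemma is_semigroup_epi_image:
  assumes "is_semigroup S" and "f \<in> epi S T"
  shows "is_semigroup T"
proof -
  have im: "carrier T = f ` carrier S"
    and mult: "\<And>x y. \<lbrakk>x \<in> carrier S; y \<in> carrier S\<rbrakk> \<Longrightarrow> f x \<otimes>\<^bsub>T\<^esub> f y = f (x \<otimes>\<^bsub>S\<^esub> y)"
    using assms(2) by (auto simp: epi_def hom_def)
  show ?thesis
    using assms(1) unfolding is_semigroup_def im by (auto simp: mult)
qed

lemma semigroup_congruence_ker:
  assumes "is_semigroup S" and "f \<in> hom S T"
  shows "semigroup_congruence S (semigroup_ker S f)"
proof -
  have "equiv (carrier S) (semigroup_ker S f)"
    by (rule equivI) (auto simp: semigroup_ker_def refl_on_def intro: symI transI)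
  then show ?thesis
    using assms by (auto simp: semigroup_congruence_def semigroup_ker_def is_semigroup_def hom_def)
qed

text \<open>This is the first isomorphism theorem, proved from \<open>T\<close> to the quotient:
  sending an element to its fibre requires no choice of representatives.\<close>

lemma epi_iso_semigroup_quotient_ker:
  assumes S: "is_semigroup S" and f: "f \<in> epi S T"
  shows "T \<cong> semigroup_quotient S (semigroup_ker S f)"
proof -
  define R where "R = semigroup_ker S f"
  define g where "g t = {x \<in> carrier S. f x = t}" for t
  have im: "carrier T = f ` carrier S" and hom: "f \<in> hom S T"
    using f by (auto simp: epi_def)
  have cong: "semigroup_congruence S R"
    unfolding R_def using semigroup_congruence_ker[OF S hom] .
  have g: "g (f x) = R `` {x}" if "x \<in> carrier S" for x
    using that by (auto simp: g_def R_def semigroup_ker_def)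
  have closed: "x \<otimes>\<^bsub>S\<^esub> y \<in> carrier S" if "x \<in> carrier S" "y \<in> carrier S" for x y
    using S that by (simp add: is_semigroup_def)
  have carr: "carrier (semigroup_quotient S R) = g ` carrier T"
    unfolding im by (auto simp: semigroup_quotient_def quotient_def g image_iff)
  have mult: "g (s \<otimes>\<^bsub>T\<^esub> t) = g s \<otimes>\<^bsub>semigroup_quotient S R\<^esub> g t"
    if "s \<in> carrier T" "t \<in> carrier T" for s t
  proof -
    obtain x y where xy: "x \<in> carrier S" "y \<in> carrier S" "s = f x" "t = f y"
      using \<open>s \<in> carrier T\<close> \<open>t \<in> carrier T\<close> unfolding im by blast
    then have "s \<otimes>\<^bsub>T\<^esub> t = f (x \<otimes>\<^bsub>S\<^esub> y)"
      using hom by (simp add: hom_def)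
    then show ?thesis
      using xy by (simp add: g closed semigroup_quotient_mult[OF S cong])
  qed
  \<comment> \<open>Each fibre over the carrier of \<open>T\<close> is nonempty, and any of its
    elements determines the point below it.\<close>
  have "inj_on g (carrier T)"
    unfolding im by (rule inj_onI) (auto simp: g_def)
  then have "g \<in> iso T (semigroup_quotient S R)"
    using mult carr by (auto simp: iso_def hom_def bij_betw_def)
  then show ?thesis
    unfolding R_def by (rule is_isoI)
qed

section \<open>Weak inverses of matrices over a field\<close>

text \<open>The product \<open>R * Q\<close> turns out to be diagonal, with ones at the nonzero rows
  of \<open>R\<close> and zeros at its zero rows, so it fixes \<open>R\<close> from the
  left.\<close>

lemma row_echelon_form_weak_inverse:
  fixes R :: "'a :: field mat"
  assumes R: "R \<in> carrier_mat nr nc" and ref: "row_echelon_form R"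
  obtains Q where "Q \<in> carrier_mat nc nr" and "R * Q * R = R"
proof -
  obtain f where f: "pivot_fun R f nc"
    using ref R by (auto simp: row_echelon_form_def)
  have dim: "dim_row R = nr" using R by simp
  note p = pivot_funD[OF dim f]
  \<comment> \<open>For a zero row \<open>i\<close> the pivot function has the value
    \<open>nc\<close>, which is no row index of \<open>Q\<close>, so column \<open>i\<close> of
    \<open>Q\<close> vanishes.\<close>
  define Q :: "'a mat" where "Q = mat nc nr (\<lambda>(j, i). if j = f i then 1 else 0)"
  have Q: "Q \<in> carrier_mat nc nr" by (simp add: Q_def)
  \<comment> \<open>\<open>Q\<close> selects the pivot columns of \<open>R\<close>, which are unit vectors.\<close>
  have RQ: "R * Q = mat nr nr (\<lambda>(i, k). if i = k \<and> f i < nc then 1 else 0)"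
  proof (rule eq_matI)
    fix i k assume "i < dim_row (mat nr nr (\<lambda>(i, k). if i = k \<and> f i < nc then 1 else 0 :: 'a))"
      "k < dim_col (mat nr nr (\<lambda>(i, k). if i = k \<and> f i < nc then 1 else 0 :: 'a))"
    then have ik: "i < nr" "k < nr" by simp_all
    have "(R * Q) $$ (i, k) = (\<Sum>j = 0..<nc. R $$ (i, j) * (if j = f k then 1 else 0))"
      using ik R by (simp add: Q_def scalar_prod_def)
    also have "\<dots> = (if f k < nc then R $$ (i, f k) else 0)"
      by (simp add: if_distrib[where f = "\<lambda>x. _ * x"] cong: if_cong)
    finally show "(R * Q) $$ (i, k) =
        mat nr nr (\<lambda>(i, k). if i = k \<and> f i < nc then 1 else 0) $$ (i, k)"
      using p ik by auto
  qed (use R Q in auto)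
  have "R * Q * R = R"
  proof (rule eq_matI)
    fix i k assume "i < dim_row R" "k < dim_col R"
    then have ik: "i < nr" "k < nc" using R by auto
    have "(R * Q * R) $$ (i, k) =
        (\<Sum>j = 0..<nr. (if i = j \<and> f i < nc then 1 else 0) * R $$ (j, k))"
      using ik R unfolding RQ by (simp add: scalar_prod_def)
    also have "\<dots> = (\<Sum>j = 0..<nr. if i = j then (if f i < nc then R $$ (j, k) else 0) else 0)"
      by (intro sum.cong) auto
    also have "\<dots> = (if f i < nc then R $$ (i, k) else 0)"
      using ik by simp
    \<comment> \<open>If \<open>f i = nc\<close>, all entries of row \<open>i\<close> lie left of
      the pivot position and are zero.\<close>
    also have "\<dots> = R $$ (i, k)"
      using p(1,2)[OF ik(1)] ik(2) by auto
    finally show "(R * Q * R) $$ (i, k) = R $$ (i, k)" .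
  qed (use R Q in auto)
  with Q show ?thesis by (rule that)
qed

text \<open>Gauss-Jordan elimination gives \<open>R = P * A\<close> and \<open>A = P' * R\<close>.
  If \<open>R * Q * R = R\<close>, then \<open>E = Q * P\<close> works, since
  \<open>A * E * A\<close> equals \<open>P' * (R * Q * R)\<close>.\<close>

lemma mat_weak_inverse:
  fixes A :: "'a :: field mat"
  assumes A: "A \<in> carrier_mat nr nc"
  obtains E where "E \<in> carrier_mat nc nr" and "A * E * A = A"
proof -
  define R where "R = gauss_jordan_single A"
  note gj = gauss_jordan_single[OF A R_def[symmetric]]
  obtain P P' where P: "R = P * A" "P \<in> carrier_mat nr nr" "P' \<in> carrier_mat nr nr"
    "P' * P = 1\<^sub>m nr"
    using gj(4) by blast
  obtain Q where Q: "Q \<in> carrier_mat nc nr" "R * Q * R = R"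
    using row_echelon_form_weak_inverse[OF gj(2,3)] .
  have A_eq: "P' * R = A"
    using assoc_mult_mat[OF P(3,2) A] A by (simp add: P(1,4))
  have QP: "Q * P \<in> carrier_mat nc nr" using Q P by simp
  have "A * (Q * P) * A = A * (Q * P * A)"
    using A QP A by (rule assoc_mult_mat)
  also have "\<dots> = A * (Q * R)"
    by (simp add: P(1) assoc_mult_mat[OF Q(1) P(2) A])
  also have "\<dots> = P' * R * (Q * R)"
    by (simp add: A_eq)
  also have "\<dots> = P' * (R * (Q * R))"
    using P(3) gj(2) mult_carrier_mat[OF Q(1) gj(2)] by (rule assoc_mult_mat)
  also have "\<dots> = P' * (R * Q * R)"
    using assoc_mult_mat[OF gj(2) Q(1) gj(2)] by simp
  also have "\<dots> = A"
    by (simp add: Q(2) A_eq)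
  finally show ?thesis
    using that QP by blast
qed

section \<open>Block matrices and the sandwich product\<close>

lemma four_block_mat_eq_iff:
  assumes "A \<in> carrier_mat nr1 nc1" "B \<in> carrier_mat nr1 nc2"
    "C \<in> carrier_mat nr2 nc1" "D \<in> carrier_mat nr2 nc2"
    and "A' \<in> carrier_mat nr1 nc1" "B' \<in> carrier_mat nr1 nc2"
    "C' \<in> carrier_mat nr2 nc1" "D' \<in> carrier_mat nr2 nc2"
  shows "four_block_mat A B C D = four_block_mat A' B' C' D' \<longleftrightarrow>
    A = A' \<and> B = B' \<and> C = C' \<and> D = D'" (is "?X = ?Y \<longleftrightarrow> _")
proof
  assume eq: "?X = ?Y"
  have entry: "?X $$ (i, j) = ?Y $$ (i, j)" for i j
    by (simp add: eq)
  have "A $$ (i, j) = A' $$ (i, j)" if "i < nr1" "j < nc1" for i j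
    using entry[of i j] that assms by simp
  moreover have "B $$ (i, j) = B' $$ (i, j)" if "i < nr1" "j < nc2" for i j
    using entry[of i "nc1 + j"] that assms by simp
  moreover have "C $$ (i, j) = C' $$ (i, j)" if "i < nr2" "j < nc1" for i j
    using entry[of "nr1 + i" j] that assms by simp
  moreover have "D $$ (i, j) = D' $$ (i, j)" if "i < nr2" "j < nc2" for i j
    using entry[of "nr1 + i" "nc1 + j"] that assms by simp
  ultimately show "A = A' \<and> B = B' \<and> C = C' \<and> D = D'"
    using assms by (intro conjI eq_matI) auto
qed simp

lemma four_block_mat_cases:
  assumes "X \<in> carrier_mat m n" "r \<le> m" "s \<le> n"
  obtains A B C D where "A \<in> carrier_mat r s" "B \<in> carrier_mat r (n - s)"
    "C \<in> carrier_mat (m - r) s" "D \<in> carrier_mat (m - r) (n - s)" "X = four_block_mat A B C D"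
proof -
  obtain A B C D where "split_block X r s = (A, B, C, D)"
    by (metis prod_cases4)
  from split_block[OF this, of "m - r" "n - s"] show ?thesis
    using assms that by auto
qed

text \<open>Right multiplication by \<open>J_mat m n r\<close> replaces the right block column by
  zeros, and these zeros then annihilate the lower block row of the second factor.\<close>

lemma four_block_mult_J_mat_mult:
  fixes A :: "'a :: field mat"
  assumes X: "A \<in> carrier_mat r r" "B \<in> carrier_mat r (n - r)"
    "C \<in> carrier_mat (m - r) r" "D \<in> carrier_mat (m - r) (n - r)"
    and Y: "A' \<in> carrier_mat r r" "B' \<in> carrier_mat r (n - r)"
    "C' \<in> carrier_mat (m - r) r" "D' \<in> carrier_mat (m - r) (n - r)"
  shows "four_block_mat A B C D * J_mat m n r * four_block_mat A' B' C' D' =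
    four_block_mat (A * A') (A * B') (C * A') (C * B')"
proof -
  have "four_block_mat A B C D * J_mat m n r =
      four_block_mat A (0\<^sub>m r (m - r)) C (0\<^sub>m (m - r) (m - r))"
    unfolding J_mat_def
    by (subst mult_four_block_mat[OF X]) (use X in auto)
  then show ?thesis
    by (simp, subst mult_four_block_mat[OF X(1) _ X(3) _ Y]) (use X Y in auto)
qed

section \<open>The map \<open>xi\<close>, its image and its kernel\<close>

lemma is_semigroup_U: "is_semigroup (U_semigroup TYPE('a :: field) m n r)"
  by (auto simp: is_semigroup_def U_semigroup_def intro!: mult_carrier_mat assoc_mult_mat)

text \<open>The left block column of the first factor is \<open>A\<close> above
  \<open>M * A\<close>, and the upper block row of the second is \<open>B\<close> beside
  \<open>B * L\<close>. Their product has the form \<open>xi\<close> with middle entry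
  \<open>A * B\<close>; associativity does the rest.\<close>

lemma xi_mult:
  fixes A :: "'a :: field mat"
  assumes "M \<in> carrier_mat (m - r) r" "A \<in> carrier_mat r r" "N \<in> carrier_mat r (n - r)"
    and "K \<in> carrier_mat (m - r) r" "B \<in> carrier_mat r r" "L \<in> carrier_mat r (n - r)"
  shows "xi (M, A, N) * J_mat m n r * xi (K, B, L) = xi (M, A * B, L)"
proof -
  have "xi (M, A, N) * J_mat m n r * xi (K, B, L) =
      four_block_mat (A * B) (A * (B * L)) (M * A * B) (M * A * (B * L))"
    unfolding xi_def prod.case
    by (rule four_block_mult_J_mat_mult) (use assms in \<open>auto intro!: mult_carrier_mat\<close>)
  moreover have "A * (B * L) = A * B * L"
    using assms by (simp add: assoc_mult_mat[of A r r B r L])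
  moreover have MA: "M * A * B = M * (A * B)"
    using assms by (simp add: assoc_mult_mat[of M "m - r" r A r B])
  moreover have "M * A * (B * L) = M * (A * B) * L"
    using assms assoc_mult_mat[OF mult_carrier_mat[OF assms(1,2)] assms(5,6)] by (simp add: MA)
  ultimately show ?thesis
    by (simp add: xi_def)
qed

lemma xi_carrier:
  assumes "r \<le> m" "r \<le> n" and "A \<in> carrier_mat r r"
    and "M \<in> carrier_mat (m - r) r" "N \<in> carrier_mat r (n - r)"
  shows "xi (M, A, N) \<in> carrier_mat m n"
proof -
  have "M * A * N \<in> carrier_mat (m - r) (n - r)"
    using assms by (intro mult_carrier_mat)
  then have "xi (M, A, N) \<in> carrier_mat (r + (m - r)) (r + (n - r))"
    unfolding xi_def prod.case by (rule four_block_carrier_mat[OF assms(3)])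
  then show ?thesis
    using assms(1,2) by simp
qed

lemma xi_image_eq_regular_elements:
  assumes r: "r \<le> m" "r \<le> n"
  shows "xi ` carrier (U_semigroup TYPE('a :: field) m n r) =
    regular_elements (sandwich_semigroup TYPE('a) m n r)"
    (is "_ ` carrier ?U = regular_elements ?S")
proof (intro Set.equalityI subsetI)
  fix X assume "X \<in> xi ` carrier ?U"
  then obtain M A N where U: "M \<in> carrier_mat (m - r) r" "A \<in> carrier_mat r r"
    "N \<in> carrier_mat r (n - r)" and X: "X = xi (M, A, N)"
    by (auto simp: U_semigroup_def)
  obtain E where E: "E \<in> carrier_mat r r" "A * E * A = A"
    using mat_weak_inverse[OF U(2)] .
  \<comment> \<open>Sandwiching keeps the outer entries of \<open>X\<close>, so those of
    \<open>Y\<close> only need the right sizes; the middle entry becomes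
    \<open>A * E * A = A\<close>.\<close>
  define Y where "Y = xi (M, E, N)"
  have "X * J_mat m n r * Y = xi (M, A * E, N)"
    unfolding X Y_def using U E(1) by (intro xi_mult)
  then have "X * J_mat m n r * Y * J_mat m n r * X = xi (M, A * E * A, N)"
    unfolding X using U E(1) by (simp add: xi_mult)
  then have "X * J_mat m n r * Y * J_mat m n r * X = X"
    by (simp add: E(2) X)
  moreover have "X \<in> carrier_mat m n" "Y \<in> carrier_mat m n"
    unfolding X Y_def using r U E(1) by (simp_all add: xi_carrier)
  ultimately show "X \<in> regular_elements ?S"
    by (auto simp: regular_elements_def sandwich_semigroup_def intro!: bexI[of _ Y])
next
  fix X assume "X \<in> regular_elements ?S"
  then obtain Y where XY: "X \<in> carrier_mat m n" "Y \<in> carrier_mat m n"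
    "X = X * J_mat m n r * Y * J_mat m n r * X"
    by (auto simp: regular_elements_def sandwich_semigroup_def)
  obtain A B C D where c: "A \<in> carrier_mat r r" "B \<in> carrier_mat r (n - r)"
    "C \<in> carrier_mat (m - r) r" "D \<in> carrier_mat (m - r) (n - r)"
    and X: "X = four_block_mat A B C D"
    using four_block_mat_cases[OF XY(1) r] .
  obtain E F G H where d: "E \<in> carrier_mat r r" "F \<in> carrier_mat r (n - r)"
    "G \<in> carrier_mat (m - r) r" "H \<in> carrier_mat (m - r) (n - r)"
    and Y: "Y = four_block_mat E F G H"
    using four_block_mat_cases[OF XY(2) r] .
  have AE: "A * E \<in> carrier_mat r r" and CE: "C * E \<in> carrier_mat (m - r) r"
    and EB: "E * B \<in> carrier_mat r (n - r)"
    using c d by auto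
  \<comment> \<open>Regularity is evaluated blockwise; after the second sandwich product only
    \<open>E\<close> remains of the blocks of \<open>Y\<close>.\<close>
  have "X = four_block_mat (A * E) (A * F) (C * E) (C * F) * J_mat m n r * X"
    using XY(3) four_block_mult_J_mat_mult[OF c d] by (simp add: X Y)
  also have "\<dots> = four_block_mat (A * E * A) (A * E * B) (C * E * A) (C * E * B)"
    unfolding X by (rule four_block_mult_J_mat_mult) (use c d in auto)
  finally have "A = A * E * A \<and> B = A * E * B \<and> C = C * E * A \<and> D = C * E * B"
    unfolding X by (subst (asm) four_block_mat_eq_iff[OF c]) (use c AE CE in auto)
  then have eq: "A * E * B = B" "C * E * A = C" "C * E * B = D"
    by auto
  have B: "A * (E * B) = B"
    using eq(1) assoc_mult_mat[OF c(1) d(1) c(2)] by simp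
  have D: "C * (E * B) = D"
    using eq(3) assoc_mult_mat[OF c(3) d(1) c(2)] by simp
  \<comment> \<open>The lower right block of this value is \<open>(C * E * A) * (E * B)\<close>,
    which is \<open>C * (E * B) = D\<close> because \<open>C * E * A = C\<close>.\<close>
  have "X = xi (C * E, A, E * B)"
    by (simp add: xi_def X eq(2) B D)
  then show "X \<in> xi ` carrier ?U"
    using c(1) CE EB by (auto simp: U_semigroup_def)
qed

text \<open>Equality of the values means equality of four blocks. The one for the lower right block
  follows from the other three by associativity, which leaves the three conditions of
  \<open>U_rel\<close>.\<close>

lemma semigroup_ker_xi:
  "semigroup_ker (U_semigroup TYPE('a :: field) m n r) xi = U_rel m n r"
proof -
  have "xi (M, A, N) = xi (K, B, L) \<longleftrightarrow> A = B \<and> M * A = K * B \<and> A * N = B * L"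
    if c: "M \<in> carrier_mat (m - r) r" "A \<in> carrier_mat r r" "N \<in> carrier_mat r (n - r)"
      "K \<in> carrier_mat (m - r) r" "B \<in> carrier_mat r r" "L \<in> carrier_mat r (n - r)"
    for M A N K B L :: "'a mat"
  proof -
    have "xi (M, A, N) = xi (K, B, L) \<longleftrightarrow>
        A = B \<and> A * N = B * L \<and> M * A = K * B \<and> M * A * N = K * B * L"
      unfolding xi_def prod.case
      by (rule four_block_mat_eq_iff) (use c in \<open>auto intro!: mult_carrier_mat\<close>)
    moreover have "M * A * N = K * B * L" if "A = B" "A * N = B * L" "M * A = K * B"
      using that c by (metis assoc_mult_mat)
    ultimately show ?thesis by blast
  qed
  then show ?thesis
    by (auto simp: semigroup_ker_def U_rel_def U_semigroup_def)
qed

theorem proposition5p11: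
  fixes m n r :: nat
  assumes "m \<ge> 1" and "n \<ge> 1" and "r \<le> min m n"
  shows "is_semigroup (U_semigroup TYPE('a :: field) m n r)
    \<and> is_semigroup (Reg (sandwich_semigroup TYPE('a) m n r))
    \<and> semigroup_congruence (U_semigroup TYPE('a) m n r) (U_rel m n r)
    \<and> xi \<in> epi (U_semigroup TYPE('a) m n r) (Reg (sandwich_semigroup TYPE('a) m n r))
    \<and> semigroup_ker (U_semigroup TYPE('a) m n r) xi = U_rel m n r
    \<and> Reg (sandwich_semigroup TYPE('a) m n r)
        \<cong> semigroup_quotient (U_semigroup TYPE('a) m n r) (U_rel m n r)"
proof -
  let ?U = "U_semigroup TYPE('a) m n r" and ?S = "sandwich_semigroup TYPE('a) m n r"
  have r: "r \<le> m" "r \<le> n" using assms(3) by auto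
  \<comment> \<open>This gives both that \<open>xi\<close> takes regular values and that it is
    surjective.\<close>
  have image: "xi ` carrier ?U = carrier (Reg ?S)"
    using xi_image_eq_regular_elements[OF r] by (simp add: Reg_def)
  have "xi (x \<otimes>\<^bsub>?U\<^esub> y) = xi x \<otimes>\<^bsub>Reg ?S\<^esub> xi y" if "x \<in> carrier ?U" "y \<in> carrier ?U" for x y
    using that by (auto simp: U_semigroup_def Reg_def sandwich_semigroup_def xi_mult)
  then have epi: "xi \<in> epi ?U (Reg ?S)"
    using image by (auto simp: epi_def hom_def)
  then have hom: "xi \<in> hom ?U (Reg ?S)"
    by (simp add: epi_def)
  show ?thesis
    \<comment> \<open>The congruence and isomorphism claims are obtained for the kernel of
      \<open>xi\<close> and then rewritten to \<open>U_rel\<close>.\<close>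
    using is_semigroup_U is_semigroup_epi_image[OF is_semigroup_U epi]
      semigroup_congruence_ker[OF is_semigroup_U hom] epi
      epi_iso_semigroup_quotient_ker[OF is_semigroup_U epi]
    by (simp add: semigroup_ker_xi)
qed

end
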